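(* Let $J$ be an almost complex structure on a real $3$-Bihom-Lie algebra $(L,[\cdot,\cdot,\cdot],\alpha,\beta)$. If $$[x,y,z]=-J[Jx,y,z]-J[x,Jy,z]-J[x,y,Jz]\quad\text{for all }x,y,z\in L,$$ then $J$ is a complex structure on $L$.
   Context: A real $3$-Bihom-Lie algebra is a $4$-tuple $(L,[\cdot,\cdot,\cdot],\alpha,\beta)$ consisting of a real vector space $L$, a $3$-linear map $[\cdot,\cdot,\cdot]\colon L\times L\times L\to L$ and two linear maps $\alpha,\beta\colon L\to L$ such that for all $x,y,z,u,v\in L$: (1) $\alpha\beta=\beta\alpha$; (2) $\alpha([x,y,z])=[\alpha(x),\alpha(y),\alpha(z)]$ and $\beta([x,y,z])=[\beta(x),\beta(y),\beta(z)]$; (3) $[\beta(x),\beta(y),\alpha(z)]=-[\beta(y),\beta(x),\alpha(z)]=-[\beta(x),\beta(z),\alpha(y)]$; (4) $[\beta^2(u),\beta^2(v),[\beta(x),\beta(y),\alpha(z)]]=[\beta^2(y),\beta^2(z),[\beta(u),\beta(v),\alpha(x)]]-[\beta^2(x),\beta^2(z),[\beta(u),\beta(v),\alpha(y)]]+[\beta^2(x),\beta^2(y),[\beta(u),\beta(v),\alpha(z)]]$. An almost complex structure on $L$ is a linear map $J\colon L\to L$ with $J^2=-\mathrm{Id}$, $J\alpha=\alpha J$ and $J\beta=\beta J$. It is a complex structure if for all $x,y,z\in L$, $$J[x,y,z]=-[Jx,Jy,Jz]+[Jx,y,z]+[x,Jy,z]+[x,y,Jz]+J[Jx,Jy,z]+J[x,Jy,Jz]+J[Jx,y,Jz].$$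 *)

theory Defs
  imports Complex_Main
begin

definition trilinear :: "('a::real_vector \<Rightarrow> 'b::real_vector \<Rightarrow> 'c::real_vector \<Rightarrow> 'd::real_vector) \<Rightarrow> bool" where
  "trilinear f \<longleftrightarrow>
     (\<forall>y z. linear (\<lambda>x. f x y z)) \<and> (\<forall>x z. linear (\<lambda>y. f x y z)) \<and> (\<forall>x y. linear (\<lambda>z. f x y z))"

(* The underlying vector space L is the whole type 'a; linear means real-linear. *)
locale three_bihom_lie_algebra =
  fixes br :: "'a::real_vector \<Rightarrow> 'a \<Rightarrow> 'a \<Rightarrow> 'a"
    and \<alpha> \<beta> :: "'a \<Rightarrow> 'a"
  assumes trilinear_br: "trilinear br"
    and linear_alpha: "linear \<alpha>"
    and linear_beta: "linear \<beta>"
    and alpha_beta: "\<alpha> \<circ> \<beta> = \<beta> \<circ> \<alpha>"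
    and alpha_br: "\<alpha> (br x y z) = br (\<alpha> x) (\<alpha> y) (\<alpha> z)"
    and beta_br: "\<beta> (br x y z) = br (\<beta> x) (\<beta> y) (\<beta> z)"
    and skew12: "br (\<beta> x) (\<beta> y) (\<alpha> z) = - br (\<beta> y) (\<beta> x) (\<alpha> z)"
    and skew23: "br (\<beta> x) (\<beta> y) (\<alpha> z) = - br (\<beta> x) (\<beta> z) (\<alpha> y)"
    and bihom_jacobi:
      "br (\<beta> (\<beta> u)) (\<beta> (\<beta> v)) (br (\<beta> x) (\<beta> y) (\<alpha> z)) =
         br (\<beta> (\<beta> y)) (\<beta> (\<beta> z)) (br (\<beta> u) (\<beta> v) (\<alpha> x))
       - br (\<beta> (\<beta> x)) (\<beta> (\<beta> z)) (br (\<beta> u) (\<beta> v) (\<alpha> y))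
       + br (\<beta> (\<beta> x)) (\<beta> (\<beta> y)) (br (\<beta> u) (\<beta> v) (\<alpha> z))"

locale almost_complex_structure = three_bihom_lie_algebra br \<alpha> \<beta>
  for br :: "'a::real_vector \<Rightarrow> 'a \<Rightarrow> 'a \<Rightarrow> 'a" and \<alpha> \<beta> :: "'a \<Rightarrow> 'a" +
  fixes J :: "'a \<Rightarrow> 'a"
  assumes linear_J: "linear J"
    and J_J: "J (J x) = - x"
    and J_alpha: "J \<circ> \<alpha> = \<alpha> \<circ> J"
    and J_beta: "J \<circ> \<beta> = \<beta> \<circ> J"

locale complex_structure = almost_complex_structure br \<alpha> \<beta> J
  for br :: "'a::real_vector \<Rightarrow> 'a \<Rightarrow> 'a \<Rightarrow> 'a" and \<alpha> \<beta> J :: "'a \<Rightarrow> 'a" +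
  assumes integrable:
    "J (br x y z) =
       - br (J x) (J y) (J z) + br (J x) y z + br x (J y) z + br x y (J z)
       + J (br (J x) (J y) z) + J (br x (J y) (J z)) + J (br (J x) y (J z))"

end

(* Applying J to the hypothesis gives J[x,y,z] = [Jx,y,z] + [x,Jy,z] + [x,y,Jz]. At (Jx,Jy,Jz) the
   hypothesis itself reads [Jx,Jy,Jz] = J[x,Jy,Jz] + J[Jx,y,Jz] + J[Jx,Jy,z], so the remaining four
   terms of the integrability condition cancel. *)

theory Submission
  imports Defs
begin

theorem proposition4p15:
  fixes br :: "'a::real_vector \<Rightarrow> 'a \<Rightarrow> 'a \<Rightarrow> 'a"
    and \<alpha> \<beta> J :: "'a \<Rightarrow> 'a"
  assumes "almost_complex_structure br \<alpha> \<beta> J"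
    and "\<And>x y z. br x y z = - J (br (J x) y z) - J (br x (J y) z) - J (br x y (J z))"
  shows "complex_structure br \<alpha> \<beta> J"
proof -
  interpret almost_complex_structure br \<alpha> \<beta> J by fact
  \<comment> \<open>At \<open>J x\<close>, \<open>J y\<close>, \<open>J z\<close> the hypothesis has
    \<open>J (J x) = - x\<close> (or its analogue in y or z) inside each bracket on the right;
    trilinearity moves that sign out.\<close>
  have neg: "br (- x) y z = - br x y z" "br x (- y) z = - br x y z" "br x y (- z) = - br x y z"
    for x y z
    using trilinear_br linear_neg[of "\<lambda>x. br x y z"] linear_neg[of "\<lambda>y. br x y z"]
      linear_neg[of "\<lambda>z. br x y z"]
    unfolding trilinear_def by auto
  note J_simps = linear_add[OF linear_J] linear_diff[OF linear_J] linear_neg[OF linear_J] J_J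
  show ?thesis
  \<comment> \<open>The interpretation supplies all inherited axioms, so only
    \<open>integrable\<close> remains.\<close>
  proof unfold_locales
    fix x y z
    \<comment> \<open>The hypothesis is applied just once: as a rewrite rule it would loop, its
      right side again consisting of brackets.\<close>
    have "J (br x y z) = J (- J (br (J x) y z) - J (br x (J y) z) - J (br x y (J z)))"
      using assms(2) by (rule arg_cong)
    also have "\<dots> = br (J x) y z + br x (J y) z + br x y (J z)"
      by (simp add: J_simps)
    finally have single: "J (br x y z) = br (J x) y z + br x (J y) z + br x y (J z)" .
    \<comment> \<open>The signs from \<open>neg\<close> cancel the minus signs before
      \<open>J\<close>.\<close>
    have "br (J x) (J y) (J z) = J (br x (J y) (J z)) + J (br (J x) y (J z)) + J (br (J x) (J y) z)"
      using assms(2)[of "J x" "J y" "J z"] by (simp add: J_simps neg)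
    with single show "J (br x y z) =
        - br (J x) (J y) (J z) + br (J x) y z + br x (J y) z + br x y (J z)
        + J (br (J x) (J y) z) + J (br x (J y) (J z)) + J (br (J x) y (J z))"
      by (simp add: algebra_simps)
  qed
qed

end
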